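(* Let $\mathcal{P}_{XYZ}$ be a fixed pmf on $\mathcal{X}\times\mathcal{Y}\times\mathcal{Z}$. Let $n>0$ be an integer and let $T_n:\{\mathcal{X}\times\mathcal{Y}\times\mathcal{Z}\}^n\to\{0,1\}$ be a deterministic test which, upon observing the sequence $\{(X_i,Y_i,Z_i)\}_{i=1}^n$, chooses either the null hypothesis (output $0$) or the alternative hypothesis (output $1$). Assume that there exists $R>0$ such that for every pmf $\mathcal{Q}_Z$ on $\mathcal{Z}$, $$(\mathcal{Q}_Z\mathcal{P}_{X|Z}\mathcal{P}_{Y|Z})^{\otimes n}\left(T_n(\{(X_i,Y_i,Z_i)\}_{i=1}^n)=0\right)\leq\exp(-nR).$$ Let also $\alpha\geq 1$. Then $$1-p_n^1\leq\exp\left(-\frac{\alpha-1}{\alpha}\,n\left(R-I_\alpha^Z(X,Y|Z)\right)\right),$$ where $p_n^1=\mathcal{P}_{XYZ}^{\otimes n}\left(T_n(\{(X_i,Y_i,Z_i)\}_{i=1}^n)=1\right)$.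
   Context: Hypothesis testing problem: under the null hypothesis the triples $(X_i,Y_i,Z_i)$ are i.i.d. from $\mathcal{P}_{XYZ}$; under the alternative they are i.i.d. from $\mathcal{Q}_Z\mathcal{P}_{X|Z}\mathcal{P}_{Y|Z}$ for some arbitrary pmf $\mathcal{Q}_Z$ on $\mathcal{Z}$, where $\mathcal{P}_{X|Z},\mathcal{P}_{Y|Z}$ are the conditional pmfs induced by $\mathcal{P}_{XYZ}$ (fixed arbitrarily at points $z$ with $\mathcal{P}_Z(z)=0$). $\mathcal{Q}_Z\mathcal{P}_{X|Z}\mathcal{P}_{Y|Z}$ is the pmf $(x,y,z)\mapsto \mathcal{Q}_Z(z)\mathcal{P}_{X|Z=z}(x)\mathcal{P}_{Y|Z=z}(y)$, and $\mathcal{P}^{\otimes n}$ denotes the $n$-fold product. Rényi divergence: for $\alpha>0$, $\alpha\neq 1$, and probability measures $\mathcal{P},\mathcal{Q}$ with densities $p,q$ with respect to a common dominating measure $\mu$, $D_\alpha(\mathcal{P}\|\mathcal{Q})=\frac{1}{\alpha-1}\log\int p^\alpha q^{1-\alpha}\,d\mu$ ($=+\infty$ if $\alpha>1$ and $\mathcal{P}\not\ll\mathcal{Q}$); $D_1$ is the Kullback–Leibler divergence. $\log$ is the natural logarithm. Definition: $I^{Z}_\alpha(X,Y|Z)=\min_{\mathcal{Q}_{Z}} D_\alpha(\mathcal{P}_{XYZ}\|\mathcal{P}_{X|Z}\mathcal{P}_{Y|Z}\mathcal{Q}_Z)$, the minimum being over all pmfs $\mathcal{Q}_Z$ on $\mathcal{Z}$.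 *)

theory Defs
  imports "HOL-Probability.Probability"
begin

definition ln_ennreal :: "ennreal \<Rightarrow> ereal" where
  "ln_ennreal x = (if x = 0 then -\<infinity> else if x = \<infinity> then \<infinity> else ereal (ln (enn2real x)))"

definition exp_ereal :: "ereal \<Rightarrow> ereal" where
  "exp_ereal x = (if x = -\<infinity> then 0 else if x = \<infinity> then \<infinity> else ereal (exp (real_of_ereal x)))"

text \<open>
  Renyi divergence of pmfs, with the counting measure as common dominating measure.
  Note that \<open>absolutely_continuous Q P\<close> means \<open>P \<lless> Q\<close>, that
  \<open>KL_divergence b Q P\<close> is the divergence of \<open>P\<close> from \<open>Q\<close>, and that the library's
  \<open>KL_divergence\<close> is a Bochner integral, hence \<open>0\<close> when the log-likelihood ratio is not integrable.
  As the negative part of that ratio is always integrable under \<open>P\<close>,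
  non-integrability means that the Kullback--Leibler divergence is \<open>\<infinity>\<close>.
  At points with \<open>q = 0\<close> the integrand below is \<open>0\<close>, as \<open>0 powr a = 0\<close>; for \<open>\<alpha> > 1\<close>
  such points carry no \<open>P\<close>-mass in the branch where the integral is used.
\<close>
definition renyi_divergence :: "real \<Rightarrow> 'a pmf \<Rightarrow> 'a pmf \<Rightarrow> ereal" where
  "renyi_divergence \<alpha> P Q =
    (if \<alpha> = 1 then
       (if absolutely_continuous (measure_pmf Q) (measure_pmf P)
           \<and> integrable (measure_pmf P) (entropy_density (exp 1) (measure_pmf Q) (measure_pmf P))
        then ereal (KL_divergence (exp 1) (measure_pmf Q) (measure_pmf P)) else \<infinity>)
     else if \<alpha> > 1 \<and> \<not> absolutely_continuous (measure_pmf Q) (measure_pmf P) then \<infinity>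
     else ereal (1 / (\<alpha> - 1)) *
       ln_ennreal (\<integral>\<^sup>+x. ennreal (pmf P x powr \<alpha> * pmf Q x powr (1 - \<alpha>)) \<partial>count_space UNIV))"

definition Z_marginal :: "('x \<times> 'y \<times> 'z) pmf \<Rightarrow> 'z pmf" where
  "Z_marginal P = map_pmf (\<lambda>(x, y, z). z) P"

text \<open>
  The next two predicates leave the kernel unconstrained at points \<open>z\<close> of \<open>P\<^sub>Z\<close>-mass \<open>0\<close>.
\<close>
definition is_cond_X :: "('x \<times> 'y \<times> 'z) pmf \<Rightarrow> ('z \<Rightarrow> 'x pmf) \<Rightarrow> bool" where
  "is_cond_X P K \<longleftrightarrow> (\<forall>z\<in>set_pmf (Z_marginal P).
     K z = map_pmf (\<lambda>(x, y, z'). x) (cond_pmf P {(x, y, z'). z' = z}))"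

definition is_cond_Y :: "('x \<times> 'y \<times> 'z) pmf \<Rightarrow> ('z \<Rightarrow> 'y pmf) \<Rightarrow> bool" where
  "is_cond_Y P K \<longleftrightarrow> (\<forall>z\<in>set_pmf (Z_marginal P).
     K z = map_pmf (\<lambda>(x, y, z'). y) (cond_pmf P {(x, y, z'). z' = z}))"

definition cond_indep_pmf :: "'z pmf \<Rightarrow> ('z \<Rightarrow> 'x pmf) \<Rightarrow> ('z \<Rightarrow> 'y pmf) \<Rightarrow> ('x \<times> 'y \<times> 'z) pmf" where
  "cond_indep_pmf QZ PXZ PYZ =
     do {z \<leftarrow> QZ; x \<leftarrow> PXZ z; y \<leftarrow> PYZ z; return_pmf (x, y, z)}"

lemma pmf_cond_indep_pmf:
  "pmf (cond_indep_pmf QZ PXZ PYZ) (x, y, z) = pmf QZ z * pmf (PXZ z) x * pmf (PYZ z) y"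
proof -
  have "cond_indep_pmf QZ PXZ PYZ =
      map_pmf (\<lambda>(z, x, y). (x, y, z)) (bind_pmf QZ (\<lambda>z. map_pmf (Pair z) (pair_pmf (PXZ z) (PYZ z))))"
    by (simp add: cond_indep_pmf_def pair_pmf_def map_pmf_def bind_assoc_pmf bind_return_pmf)
  also have "pmf \<dots> ((\<lambda>(z, x, y). (x, y, z)) (z, x, y)) =
      pmf (bind_pmf QZ (\<lambda>z. map_pmf (Pair z) (pair_pmf (PXZ z) (PYZ z)))) (z, x, y)"
    by (rule pmf_map_inj') (auto simp: inj_on_def)
  also have "\<dots> = (\<integral>z'. indicator {z} z' * pmf (pair_pmf (PXZ z) (PYZ z)) (x, y) \<partial>measure_pmf QZ)"
    unfolding pmf_bind
  proof (rule Bochner_Integration.integral_cong[OF refl])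
    fix z'
    show "pmf (map_pmf (Pair z') (pair_pmf (PXZ z') (PYZ z'))) (z, x, y) =
        indicator {z} z' * pmf (pair_pmf (PXZ z) (PYZ z)) (x, y)"
    proof (cases "z' = z")
      case True
      then show ?thesis
        using pmf_map_inj'[of "Pair z" "pair_pmf (PXZ z) (PYZ z)" "(x, y)"]
        by (simp add: inj_on_def)
    next
      case False
      then show ?thesis by (auto simp: pmf_eq_0_set_pmf)
    qed
  qed
  also have "\<dots> = pmf QZ z * pmf (PXZ z) x * pmf (PYZ z) y"
    by (simp add: pmf.rep_eq[symmetric] measure_pmf_single pmf_pair)
  finally show ?thesis by simp
qed

text \<open>
  The minimum over \<open>Q\<^sub>Z\<close> is written as an infimum in the extended reals; the two agree
  whenever the minimum exists.
\<close>
definition cond_renyi_MI_Z ::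
  "real \<Rightarrow> ('x \<times> 'y \<times> 'z) pmf \<Rightarrow> ('z \<Rightarrow> 'x pmf) \<Rightarrow> ('z \<Rightarrow> 'y pmf) \<Rightarrow> ereal" where
  "cond_renyi_MI_Z \<alpha> P PXZ PYZ = (INF QZ. renyi_divergence \<alpha> P (cond_indep_pmf QZ PXZ PYZ))"

text \<open>
  The library's \<open>replicate_pmf n p\<close> is the \<open>n\<close>-fold product on lists of length \<open>n\<close>.
\<close>
lemma pmf_replicate_pmf:
  "pmf (replicate_pmf n p) xs = (if length xs = n then (\<Prod>i<n. pmf p (xs ! i)) else 0)"
proof (induction n arbitrary: xs)
  case 0
  then show ?case by auto
next
  case (Suc n)
  have eq: "replicate_pmf (Suc n) p = map_pmf (\<lambda>(x, xs). x # xs) (pair_pmf p (replicate_pmf n p))"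
    by (simp add: pair_pmf_def map_pmf_def bind_assoc_pmf bind_return_pmf)
  show ?case
  proof (cases xs)
    case Nil
    then show ?thesis by (auto simp: eq pmf_eq_0_set_pmf)
  next
    case (Cons y ys)
    have "pmf (replicate_pmf (Suc n) p) xs = pmf (pair_pmf p (replicate_pmf n p)) (y, ys)"
      unfolding eq Cons
      using pmf_map_inj'[of "\<lambda>(x, xs). x # xs" "pair_pmf p (replicate_pmf n p)" "(y, ys)"]
      by (simp add: inj_on_def)
    then show ?thesis
      using Suc.IH[of ys] by (simp add: Cons pmf_pair prod.lessThan_Suc_shift del: prod.lessThan_Suc replicate_pmf.simps)
  qed
qed

end

theory Submission
  imports Defs
begin

text \<open>
  Fix \<open>Q\<close> and a test set \<open>A\<close>, and let \<open>w\<close> be the likelihood ratio of the \<open>n\<close>-fold products.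
  Integrating the tangent line of the convex function \<open>w \<mapsto> w\<^sup>\<alpha>\<close> at \<open>s = L / b\<close> over \<open>A\<close>,
  with \<open>L = P\<^sup>n(A)\<close> and \<open>Q\<^sup>n(A) \<le> b\<close>, gives \<open>L\<^sup>\<alpha> \<le> b\<^sup>\<alpha>\<^sup>-\<^sup>1 S\<^sup>n\<close>, where \<open>S\<close> is the integral of \<open>p\<^sup>\<alpha> q\<^sup>1\<^sup>-\<^sup>\<alpha>\<close>.
  For \<open>b = exp (- n R)\<close> this is a lower bound on the Renyi divergence of \<open>P\<close> from \<open>Q\<close>
  that does not depend on \<open>Q\<close>, hence also a lower bound on the infimum over \<open>Q\<^sub>Z\<close>.
\<close>

text \<open>Young's inequality with weights \<open>1 / \<alpha>\<close> and
  \<open>1 - 1 / \<alpha>\<close>: the weighted geometric mean of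
  \<open>s powr (1 - \<alpha>) * w powr \<alpha>\<close> and \<open>s\<close> is exactly
  \<open>w\<close>. This is the tangent inequality at \<open>s\<close>, solved for its linear
  term.\<close>

lemma powr_tangent_ge:
  fixes w s \<alpha> :: real
  assumes "w \<ge> 0" "s > 0" "\<alpha> > 1"
  shows "w \<le> s powr (1 - \<alpha>) / \<alpha> * w powr \<alpha> + (1 - 1 / \<alpha>) * s"
proof (cases "w = 0")
  case True
  with assms show ?thesis by simp
next
  case False
  have w: "w = (s powr (1 - \<alpha>) * w powr \<alpha>) powr (1 / \<alpha>) * s powr (1 - 1 / \<alpha>)"
    using False assms
    by (simp add: powr_mult powr_powr powr_add[symmetric] diff_divide_distrib)
  have "\<dots> \<le> 1 / \<alpha> * (s powr (1 - \<alpha>) * w powr \<alpha>) + (1 - 1 / \<alpha>) * s"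
    using False assms by (intro Youngs_inequality_0) auto
  with w show ?thesis by simp
qed

lemma absolutely_continuous_pmfD:
  assumes "absolutely_continuous (measure_pmf Q) (measure_pmf P)" "pmf Q x = 0"
  shows "pmf P x = 0"
proof -
  have "{x} \<in> null_sets (measure_pmf Q)"
    using assms(2) by (simp add: null_sets_def emeasure_pmf_single)
  then have "{x} \<in> null_sets (measure_pmf P)"
    using assms(1) by (auto simp: absolutely_continuous_def)
  then show ?thesis by (simp add: null_sets_def emeasure_pmf_single)
qed

lemma nn_integral_pmf_ratio:
  assumes ac: "absolutely_continuous (measure_pmf Q) (measure_pmf P)"
  shows "(\<integral>\<^sup>+x. g x \<partial>measure_pmf P) = (\<integral>\<^sup>+x. ennreal (pmf P x / pmf Q x) * g x \<partial>measure_pmf Q)"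
proof -
  \<comment> \<open>Where \<open>pmf Q x = 0\<close> the quotient is \<open>0\<close> by the
    convention for division, and absolute continuity makes the left side vanish as well.\<close>
  have "ennreal (pmf P x) * g x = ennreal (pmf Q x) * (ennreal (pmf P x / pmf Q x) * g x)" for x
    using absolutely_continuous_pmfD[OF ac, of x]
    by (cases "pmf Q x = 0") (auto simp: mult.assoc[symmetric] ennreal_mult[symmetric])
  then show ?thesis by (simp add: nn_integral_measure_pmf)
qed

lemma nn_integral_replicate_pmf_Suc:
  "(\<integral>\<^sup>+xs. g xs \<partial>measure_pmf (replicate_pmf (Suc n) p)) =
   (\<integral>\<^sup>+x. (\<integral>\<^sup>+xs. g (x # xs) \<partial>measure_pmf (replicate_pmf n p)) \<partial>measure_pmf p)"
  by simp

text \<open>Change of measure for product measures, one coordinate at a time. The integrand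
  \<open>g\<close> is generalized in the induction because splitting off the head \<open>x\<close>
  leaves the integrand \<open>\<lambda>xs. g (x # xs)\<close>.\<close>

lemma nn_integral_replicate_pmf_ratio:
  assumes ac: "absolutely_continuous (measure_pmf Q) (measure_pmf P)"
  shows "(\<integral>\<^sup>+xs. g xs \<partial>measure_pmf (replicate_pmf n P)) =
    (\<integral>\<^sup>+xs. ennreal (\<Prod>x\<leftarrow>xs. pmf P x / pmf Q x) * g xs \<partial>measure_pmf (replicate_pmf n Q))"
proof (induction n arbitrary: g)
  case 0
  then show ?case by simp
next
  case (Suc n)
  have nonneg: "0 \<le> (\<Prod>x\<leftarrow>xs. pmf P x / pmf Q x)" for xs
    by (intro prod_list_nonneg) auto
  show ?case
    unfolding nn_integral_replicate_pmf_Suc Suc.IH nn_integral_pmf_ratio[OF ac]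
    by (simp add: ennreal_mult nonneg mult.assoc nn_integral_cmult del: times_divide_eq_left)
qed

lemma nn_integral_replicate_pmf_prod_list:
  fixes f :: "'a \<Rightarrow> real"
  assumes "\<And>x. f x \<ge> 0"
  shows "(\<integral>\<^sup>+xs. ennreal (\<Prod>x\<leftarrow>xs. f x) \<partial>measure_pmf (replicate_pmf n p)) =
    (\<integral>\<^sup>+x. ennreal (f x) \<partial>measure_pmf p) ^ n"
proof (induction n)
  case 0
  then show ?case by simp
next
  case (Suc n)
  have nonneg: "0 \<le> (\<Prod>x\<leftarrow>xs. f x)" for xs
    using assms by (intro prod_list_nonneg) auto
  show ?case
    unfolding nn_integral_replicate_pmf_Suc
    using Suc by (simp add: ennreal_mult nonneg assms nn_integral_cmult nn_integral_multc)
qed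

lemma powr_prod_list:
  fixes f :: "'a \<Rightarrow> real"
  assumes "\<And>x. f x \<ge> 0"
  shows "(\<Prod>x\<leftarrow>xs. f x) powr a = (\<Prod>x\<leftarrow>xs. f x powr a)"
proof (induction xs)
  case (Cons x xs)
  have "0 \<le> (\<Prod>x\<leftarrow>xs. f x)"
    using assms by (intro prod_list_nonneg) auto
  with Cons assms show ?case by (simp add: powr_mult)
qed simp

text \<open>Turns the Renyi integral into a moment of the likelihood ratio under \<open>Q\<close>.
  Points with \<open>pmf Q x = 0\<close> contribute \<open>0\<close> on both sides:
  \<open>0 powr (1 - \<alpha>)\<close> is \<open>0\<close> on the left, and the weight vanishes on
  the right.\<close>

lemma nn_integral_renyi_eq:
  "(\<integral>\<^sup>+x. ennreal (pmf P x powr \<alpha> * pmf Q x powr (1 - \<alpha>)) \<partial>count_space UNIV) =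
   (\<integral>\<^sup>+x. ennreal ((pmf P x / pmf Q x) powr \<alpha>) \<partial>measure_pmf Q)"
proof -
  have "pmf P x powr \<alpha> * pmf Q x powr (1 - \<alpha>) = pmf Q x * (pmf P x / pmf Q x) powr \<alpha>" for x
    by (cases "pmf Q x = 0") (auto simp: powr_diff powr_divide)
  then show ?thesis by (simp add: nn_integral_measure_pmf ennreal_mult)
qed

lemma replicate_pmf_prob_powr_le:
  fixes P Q :: "'a pmf" and A :: "'a list set" and S :: real
  assumes ac: "absolutely_continuous (measure_pmf Q) (measure_pmf P)"
    and S: "(\<integral>\<^sup>+x. ennreal ((pmf P x / pmf Q x) powr \<alpha>) \<partial>measure_pmf Q) = ennreal S" "S \<ge> 0"
    and b: "measure_pmf.prob (replicate_pmf n Q) A \<le> b" "b > 0"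
    and L: "measure_pmf.prob (replicate_pmf n P) A > 0"
    and "\<alpha> > 1"
  shows "measure_pmf.prob (replicate_pmf n P) A powr \<alpha> \<le> b powr (\<alpha> - 1) * S ^ n"
proof -
  define L where "L = measure_pmf.prob (replicate_pmf n P) A"
  \<comment> \<open>With this choice \<open>(1 - 1 / \<alpha>) * s * b\<close> equals
    \<open>(1 - 1 / \<alpha>) * L\<close>, which can later be absorbed into the left-hand
    side.\<close>
  define s where "s = L / b"
  define w where "w = (\<lambda>xs. \<Prod>x\<leftarrow>xs. pmf P x / pmf Q x)"
  have pos: "L > 0" "s > 0" using L b by (auto simp: L_def s_def)
  have w0: "w xs \<ge> 0" for xs
    unfolding w_def by (intro prod_list_nonneg) auto
  \<comment> \<open>Only the linear terms carry the indicator. Off \<open>A\<close> the left side is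
    \<open>0\<close> and the power term is nonnegative, so that term can be integrated over the
    whole space, where it factorizes into \<open>S ^ n\<close>.\<close>
  have tangent: "ennreal (w xs) * indicator A xs \<le>
      ennreal (s powr (1 - \<alpha>) / \<alpha>) * ennreal (w xs powr \<alpha>) + ennreal ((1 - 1 / \<alpha>) * s) * indicator A xs" for xs
    using powr_tangent_ge[OF w0 \<open>s > 0\<close> \<open>\<alpha> > 1\<close>, of xs] pos \<open>\<alpha> > 1\<close>
    by (auto simp: indicator_def ennreal_mult[symmetric] ennreal_plus[symmetric]
        simp del: ennreal_plus intro!: ennreal_leI)
  have "ennreal L = (\<integral>\<^sup>+xs. ennreal (w xs) * indicator A xs \<partial>measure_pmf (replicate_pmf n Q))"
    using nn_integral_replicate_pmf_ratio[OF ac, of n "indicator A"]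
    by (simp add: L_def w_def measure_pmf.emeasure_eq_measure)
  also have "\<dots> \<le> (\<integral>\<^sup>+xs. ennreal (s powr (1 - \<alpha>) / \<alpha>) * ennreal (w xs powr \<alpha>) +
      ennreal ((1 - 1 / \<alpha>) * s) * indicator A xs \<partial>measure_pmf (replicate_pmf n Q))"
    by (intro nn_integral_mono tangent)
  also have "\<dots> = ennreal (s powr (1 - \<alpha>) / \<alpha>) * ennreal S ^ n +
      ennreal ((1 - 1 / \<alpha>) * s) * ennreal (measure_pmf.prob (replicate_pmf n Q) A)"
    using nn_integral_replicate_pmf_prod_list[of "\<lambda>x. (pmf P x / pmf Q x) powr \<alpha>" n Q]
    by (simp add: nn_integral_add nn_integral_cmult w_def powr_prod_list S
        measure_pmf.emeasure_eq_measure)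
  also have "\<dots> \<le> ennreal (s powr (1 - \<alpha>) / \<alpha>) * ennreal S ^ n + ennreal ((1 - 1 / \<alpha>) * s) * ennreal b"
    using b by (intro add_left_mono mult_left_mono ennreal_leI) auto
  also have "\<dots> = ennreal (s powr (1 - \<alpha>) / \<alpha> * S ^ n + (1 - 1 / \<alpha>) * L)"
    using pos b S \<open>\<alpha> > 1\<close>
    by (simp add: ennreal_mult[symmetric] ennreal_plus[symmetric] ennreal_power s_def del: ennreal_plus)
  finally have "L \<le> s powr (1 - \<alpha>) / \<alpha> * S ^ n + (1 - 1 / \<alpha>) * L"
    using pos S \<open>\<alpha> > 1\<close> by (subst (asm) ennreal_le_iff) auto
  then have "L \<le> s powr (1 - \<alpha>) * S ^ n"
    using \<open>\<alpha> > 1\<close> by (simp add: field_simps)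
  \<comment> \<open>As \<open>s powr (1 - \<alpha>)\<close> is
    \<open>L powr (1 - \<alpha>) * b powr (\<alpha> - 1)\<close>, this factor cancels
    \<open>L\<close> on the right and completes \<open>L powr \<alpha>\<close> on the left.\<close>
  then have "L * L powr (\<alpha> - 1) \<le> s powr (1 - \<alpha>) * S ^ n * L powr (\<alpha> - 1)"
    by (rule mult_right_mono) simp
  also have "\<dots> = b powr (\<alpha> - 1) * S ^ n"
    using pos b by (simp add: s_def powr_divide powr_diff field_simps)
  also have "L * L powr (\<alpha> - 1) = L powr \<alpha>"
    using pos by (simp add: powr_diff)
  finally show ?thesis by (simp add: L_def)
qed

text \<open>When the divergence is finite, taking logarithms in
  \<open>replicate_pmf_prob_powr_le\<close> and dividing by \<open>(\<alpha> - 1) * n\<close>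
  isolates \<open>ln S / (\<alpha> - 1)\<close>, which is the divergence.\<close>

lemma renyi_divergence_ge:
  fixes P Q :: "'a pmf"
  assumes "n > 0" "\<alpha> > 1"
    and b: "measure_pmf.prob (replicate_pmf n Q) A \<le> exp (- real n * R)"
    and L: "measure_pmf.prob (replicate_pmf n P) A > 0"
  shows "ereal (R + ln (measure_pmf.prob (replicate_pmf n P) A) / ((\<alpha> - 1) / \<alpha> * real n))
    \<le> renyi_divergence \<alpha> P Q"
proof (cases "absolutely_continuous (measure_pmf Q) (measure_pmf P) \<and>
    (\<integral>\<^sup>+x. ennreal ((pmf P x / pmf Q x) powr \<alpha>) \<partial>measure_pmf Q) \<noteq> \<infinity>")
  \<comment> \<open>Either failure, of absolute continuity or of finiteness of the integral, makes
    the divergence \<open>\<infinity>\<close>.\<close>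
  case False
  then show ?thesis
    using \<open>\<alpha> > 1\<close> by (auto simp: renyi_divergence_def ln_ennreal_def nn_integral_renyi_eq)
next
  case True
  then obtain S where S: "(\<integral>\<^sup>+x. ennreal ((pmf P x / pmf Q x) powr \<alpha>) \<partial>measure_pmf Q) = ennreal S" "S \<ge> 0"
    by (metis ennreal_cases infinity_ennreal_def)
  define L where "L = measure_pmf.prob (replicate_pmf n P) A"
  have le: "L powr \<alpha> \<le> exp (- real n * R) powr (\<alpha> - 1) * S ^ n"
    unfolding L_def using True S b L \<open>\<alpha> > 1\<close> by (intro replicate_pmf_prob_powr_le) auto
  have "L > 0" using L by (simp add: L_def)
  then have "L powr \<alpha> > 0" by simp
  \<comment> \<open>For \<open>S = 0\<close> the bound would be \<open>0\<close>, since
    \<open>n > 0\<close>, contradicting \<open>L > 0\<close>. Hence \<open>ln S\<close> is a genuine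
    logarithm below.\<close>
  with le \<open>n > 0\<close> have "S \<noteq> 0" by (intro notI) (simp add: power_0_left)
  with S have "S > 0" by simp
  have "ln (L powr \<alpha>) \<le> ln (exp (- real n * R) powr (\<alpha> - 1) * S ^ n)"
    using le \<open>L powr \<alpha> > 0\<close> by (rule ln_mono)
  then have "\<alpha> * ln L \<le> (\<alpha> - 1) * (- real n * R) + real n * ln S"
    using \<open>L > 0\<close> \<open>S > 0\<close> by (simp add: ln_mult ln_powr ln_realpow)
  then have "\<alpha> * ln L / ((\<alpha> - 1) * real n) \<le>
      ((\<alpha> - 1) * (- real n * R) + real n * ln S) / ((\<alpha> - 1) * real n)"
    using \<open>\<alpha> > 1\<close> by (intro divide_right_mono) auto
  also have "\<dots> = ln S / (\<alpha> - 1) - R"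
    using \<open>n > 0\<close> \<open>\<alpha> > 1\<close> by (simp add: diff_divide_distrib)
  finally have "R + ln L / ((\<alpha> - 1) / \<alpha> * real n) \<le> ln S / (\<alpha> - 1)"
    by (simp add: mult.commute)
  then show ?thesis
    using True S \<open>S > 0\<close> \<open>\<alpha> > 1\<close>
    by (simp add: renyi_divergence_def ln_ennreal_def nn_integral_renyi_eq L_def)
qed

theorem theorem5:
  fixes P :: "('x \<times> 'y \<times> 'z) pmf"
    and PXZ :: "'z \<Rightarrow> 'x pmf" and PYZ :: "'z \<Rightarrow> 'y pmf"
    and n :: nat and T :: "('x \<times> 'y \<times> 'z) list \<Rightarrow> nat" and R \<alpha> :: real
  assumes "is_cond_X P PXZ" and "is_cond_Y P PYZ"
    and "n > 0"
    and "T \<in> {xs. length xs = n} \<rightarrow> {0, 1}"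
    and "R > 0"
    and "\<And>QZ :: 'z pmf.
      measure_pmf.prob (replicate_pmf n (cond_indep_pmf QZ PXZ PYZ)) {xs. T xs = 0} \<le> exp (- real n * R)"
    and "\<alpha> \<ge> 1"
  shows "ereal (1 - measure_pmf.prob (replicate_pmf n P) {xs. T xs = 1})
    \<le> exp_ereal (- (ereal ((\<alpha> - 1) / \<alpha> * real n) * (ereal R - cond_renyi_MI_Z \<alpha> P PXZ PYZ)))"
proof -
  define L where "L = measure_pmf.prob (replicate_pmf n P) {xs. T xs = 0}"
  define c where "c = (\<alpha> - 1) / \<alpha> * real n"
  let ?I = "cond_renyi_MI_Z \<alpha> P PXZ PYZ"
  have "1 - measure_pmf.prob (replicate_pmf n P) {xs. T xs = 1} =
      measure_pmf.prob (replicate_pmf n P) (- {xs. T xs = 1})"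
    using measure_pmf.prob_compl[of "{xs. T xs = 1}" "replicate_pmf n P"] by (simp add: Compl_eq_Diff_UNIV)
  \<comment> \<open>\<open>T\<close> is known to be binary only on lists of length \<open>n\<close>,
    but these carry all the mass of the product, so the two events agree almost everywhere.\<close>
  also have "\<dots> = L"
    unfolding L_def
  proof (rule measure_pmf.finite_measure_eq_AE)
    show "AE xs in measure_pmf (replicate_pmf n P). xs \<in> - {xs. T xs = 1} \<longleftrightarrow> xs \<in> {xs. T xs = 0}"
      using assms(4) by (auto simp: AE_measure_pmf_iff set_replicate_pmf)
  qed auto
  finally have L: "1 - measure_pmf.prob (replicate_pmf n P) {xs. T xs = 1} = L" .
  have "ereal L \<le> exp_ereal (- (ereal c * (ereal R - ?I)))"
  \<comment> \<open>For \<open>\<alpha> = 1\<close> the factor \<open>c\<close> is \<open>0\<close>,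
    and so is its product with \<open>R - ?I\<close>, even if \<open>?I\<close> is infinite; the
    bound is then \<open>exp 0 = 1\<close>. For \<open>L \<le> 0\<close> nonnegativity of
    \<open>exp_ereal\<close> suffices. Otherwise division by \<open>c\<close> and
    \<open>ln L\<close> make sense.\<close>
  proof (cases "\<alpha> = 1 \<or> L \<le> 0")
    case True
    then show ?thesis
    proof
      assume "\<alpha> = 1"
      then have "c = 0" by (simp add: c_def)
      moreover have "L \<le> 1" by (simp add: L_def)
      ultimately show ?thesis
        by (simp add: exp_ereal_def zero_ereal_def[symmetric])
    next
      assume "L \<le> 0"
      then show ?thesis
        by (auto simp: exp_ereal_def intro: order_trans[of L 0])
    qed
  next
    case False
    with assms(7) have "\<alpha> > 1" "L > 0" by auto
    with assms(3) have "c > 0" by (simp add: c_def)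
    have ge: "ereal (R + ln L / c) \<le> ?I"
      unfolding cond_renyi_MI_Z_def L_def c_def
      using assms(3,6) \<open>\<alpha> > 1\<close> \<open>L > 0\<close> by (intro INF_greatest renyi_divergence_ge) (auto simp: L_def)
    show ?thesis
    proof (cases ?I)
      case (real r)
      with ge have "ln L / c \<le> r - R" by simp
      with \<open>c > 0\<close> have "ln L \<le> - (c * (R - r))" by (simp add: field_simps)
      with \<open>L > 0\<close> have "L \<le> exp (- (c * (R - r)))"
        by (metis exp_le_cancel_iff exp_ln)
      with real show ?thesis by (simp add: exp_ereal_def)
    \<comment> \<open>For \<open>?I = \<infinity>\<close> the right-hand side is
      \<open>\<infinity>\<close>; the value \<open>-\<infinity>\<close> is excluded by the real
      lower bound \<open>ge\<close>.\<close>
    qed (use ge \<open>c > 0\<close> in \<open>auto simp: exp_ereal_def\<close>)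
  qed
  with L show ?thesis by (simp add: c_def)
qed

end
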